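(* Let $x,y$ be real numbers with $x+y\neq 0$ and $x/(x+y)\geq 0$, let $z\in(-\infty,1]$, and let $n,p$ be positive integers. Then \[ \sum_{k=0}^n x^ky^{n-k}\binom{n}{k}\, \zeta_k^\star(\{1\}_p;z) =(-1)^{p-1} (x+y)^n \sum_{j=1}^n \left(\Big(\frac{xz+y}{x+y}\Big)^j-\Big(\frac{y}{x+y}\Big)^j\right)\left\{\sum_{i=0}^{p-1} (-1)^i \frac{Y_i(n)}{i!}\, \frac{s(j,p-i)}{j!}\right\}. \]
   Context: For a composition $\mathbf{k}=(k_1,\ldots,k_r)$ of positive integers, an integer $n\geq 0$ and a real $z$, define $\zeta^\star_n(\mathbf{k};z):=\sum_{n\geq n_1\geq\cdots\geq n_r\geq 1} \frac{z^{n_r}}{n_1^{k_1}\cdots n_r^{k_r}}$ (an empty sum, equal to $0$, when $n=0$). $\{1\}_p$ denotes the sequence $(1,\ldots,1)$ with $p$ entries. The convention $0^0=1$ is used. $s(n,k)$ denotes the unsigned Stirling numbers of the first kind, defined by $s(0,0)=1$, $s(n,0)=s(0,k)=0$ for $n,k\geq1$, and $s(n,k)=s(n-1,k-1)+(n-1)s(n-1,k)$ for $n,k\geq 1$ (so $s(n,k)=0$ if $n<k$). For integers $n\geq 0$, $k\geq 1$ let $H_n^{(k)}=\sum_{j=1}^n j^{-k}$ and $H_n=H_n^{(1)}$. The complete exponential Bell polynomials $Y_k(x_1,\ldots,x_k)$ are defined by $\exp\big(\sum_{i\geq1} x_i t^i/i!\big)=\sum_{k\geq0} Y_k(x_1,\ldots,x_k)\,t^k/k!$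 (so $Y_0=1$, $Y_1=x_1$, $Y_2=x_1^2+x_2$, ...), and the Bell numbers are $Y_k(n):=Y_k\big(H_n,1!H_n^{(2)},2!H_n^{(3)},\ldots,(k-1)!H_n^{(k)}\big)$, with $Y_0(n)=1$. *)

theory Defs
  imports
    Complex_Main
    "HOL-Combinatorics.Stirling"
    "HOL-Computational_Algebra.Formal_Power_Series"
begin

text \<open>
  A composition \<open>(k\<^sub>1, \<dots>, k\<^sub>r)\<close> is a non-empty list of positive naturals. The summation index
  \<open>n \<ge> n\<^sub>1 \<ge> \<dots> \<ge> n\<^sub>r \<ge> 1\<close> is a weakly decreasing list \<open>ns\<close> of the same length, so
  \<open>last ns\<close> is \<open>n\<^sub>r\<close>. (For the empty list, which is not a composition, \<open>last\<close> is unspecified.)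
\<close>

definition star_indices :: "nat \<Rightarrow> nat \<Rightarrow> nat list set" where
  "star_indices n r = {ns. length ns = r \<and> set ns \<subseteq> {1..n} \<and> sorted_wrt (\<ge>) ns}"

definition zeta_star :: "nat \<Rightarrow> nat list \<Rightarrow> real \<Rightarrow> real" where
  "zeta_star n ks z =
     (\<Sum>ns\<in>star_indices n (length ks).
        z ^ last ns / (\<Prod>i<length ks. real (ns ! i) ^ (ks ! i)))"

lemma finite_star_indices: "finite (star_indices n r)"
proof (rule finite_subset)
  show "star_indices n r \<subseteq> {ns. set ns \<subseteq> {1..n} \<and> length ns = r}"
    by (auto simp: star_indices_def)
  show "finite {ns. set ns \<subseteq> {1..n} \<and> length ns = r}"
    by (rule finite_lists_length_eq) simp
qed

definition gen_harm :: "nat \<Rightarrow> nat \<Rightarrow> real" where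
  "gen_harm k n = (\<Sum>j=1..n. 1 / real j ^ k)"

text \<open>
  \<open>bell_poly k x\<close> is \<open>Y\<^sub>k(x 1, \<dots>, x k)\<close>, defined through the exponential generating function
  \<open>exp (\<Sum>i\<ge>1. x i * t^i / i!) = (\<Sum>k. Y\<^sub>k * t^k / k!)\<close>; the value \<open>x 0\<close> is not used.
\<close>

definition bell_poly :: "nat \<Rightarrow> (nat \<Rightarrow> real) \<Rightarrow> real" where
  "bell_poly k x =
     fact k * fps_nth (fps_exp 1 oo Abs_fps (\<lambda>i. if i = 0 then 0 else x i / fact i)) k"

lemma bell_poly_0: "bell_poly 0 x = 1"
  by (simp add: bell_poly_def)

lemma bell_poly_1: "bell_poly 1 x = x 1"
  by (simp add: bell_poly_def fps_compose_nth)

lemma bell_poly_2: "bell_poly 2 x = x 1 ^ 2 + x 2"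
  by (simp add: bell_poly_def fps_compose_nth numeral_2_eq_2 fps_mult_nth field_simps)

definition bell_number :: "nat \<Rightarrow> nat \<Rightarrow> real" where
  "bell_number k n = bell_poly k (\<lambda>i. fact (i - 1) * gen_harm i n)"

end

theory Submission
  imports Defs
begin

text \<open>
  For \<open>p \<ge> 1\<close>, write \<open>L n p\<close> for the left-hand side, and set \<open>L n 0 = (x z + y)\<^sup>n - y\<^sup>n\<close>. Pascal's rule,
  \<open>\<zeta>\<^sup>\<star>\<^sub>k({1}\<^sub>p) = \<zeta>\<^sup>\<star>\<^sub>k\<^sub>-\<^sub>1({1}\<^sub>p) + \<zeta>\<^sup>\<star>\<^sub>k({1}\<^sub>p\<^sub>-\<^sub>1) / k\<close> and \<open>n * C(n-1,k-1) = k * C(n,k)\<close> give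
  \<open>L n p = (x + y) * L (n-1) p + L n (p-1) / n\<close>. The right-hand side satisfies the same recursion,
  because its generating function in \<open>p\<close> is
  \<open>(x + y)\<^sup>n * (\<Sum>j=1..n. w\<^sub>j * t (1 - t) \<dots> (j - 1 - t) / j!) / (\<Prod>m=1..n. 1 - t / m)\<close>, where
  \<open>w\<^sub>j\<close> is the difference of \<open>j\<close>-th powers.
\<close>

section \<open>Power series of the Bell numbers\<close>

text \<open>Comparing coefficients, the earlier ones determine \<open>Suc k\<close> times the one at
  \<open>Suc k\<close>, and that factor is invertible in characteristic 0.\<close>

lemma fps_linear_ode_unique:
  fixes F G h :: "'a::field_char_0 fps"
  assumes F: "fps_deriv F = h * F" and G: "fps_deriv G = h * G"
    and init: "fps_nth F 0 = fps_nth G 0"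
  shows "F = G"
proof (rule fps_ext)
  fix m
  show "fps_nth F m = fps_nth G m"
  proof (induction m rule: less_induct)
    case (less m)
    show ?case
    proof (cases m)
      case 0
      then show ?thesis using init by simp
    next
      case (Suc k)
      have step: "of_nat (Suc k) * fps_nth A (Suc k) = (\<Sum>i=0..k. fps_nth h i * fps_nth A (k - i))"
        if "fps_deriv A = h * A" for A :: "'a fps"
        using arg_cong[OF that, of "\<lambda>A. fps_nth A k"] by (simp add: fps_mult_nth)
      have "of_nat (Suc k) * fps_nth F (Suc k) = of_nat (Suc k) * fps_nth G (Suc k)"
        unfolding step[OF F] step[OF G] using less Suc by (intro sum.cong) auto
      then show ?thesis
        using Suc by (simp del: of_nat_Suc)
    qed
  qed
qed

text \<open>Having power sums of 1/1, ..., 1/n as numerators, this is the logarithm of the product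
  of 1 / (1 - t/m) over m = 1, ..., n.\<close>

definition harm_fps :: "nat \<Rightarrow> real fps" where
  "harm_fps n = Abs_fps (\<lambda>i. if i = 0 then 0 else gen_harm i n / real i)"

definition bell_fps :: "nat \<Rightarrow> real fps" where
  "bell_fps n = fps_exp 1 oo harm_fps n"

lemma fps_nth_mult_one_minus_const_X:
  fixes F :: "'a::comm_ring_1 fps"
  shows "fps_nth ((1 - fps_const c * fps_X) * F) m =
    fps_nth F m - (if m = 0 then 0 else c * fps_nth F (m - 1))"
  by (simp add: left_diff_distrib mult.assoc)

lemma gen_harm_Suc: "gen_harm k (Suc n) = gen_harm k n + 1 / real (Suc n) ^ k"
  by (simp add: gen_harm_def)

lemma bell_number_eq_fps_nth: "bell_number i n / fact i = fps_nth (bell_fps n) i"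
proof -
  have "(\<lambda>i. if i = 0 then 0 else (fact (i - 1) * gen_harm i n) / fact i)
      = (\<lambda>i. if i = 0 then 0 else gen_harm i n / real i)"
    by (auto simp: fun_eq_iff fact_reduce)
  then show ?thesis
    by (simp add: bell_number_def bell_poly_def bell_fps_def harm_fps_def cong: if_cong)
qed

lemma deriv_bell_fps: "fps_deriv (bell_fps n) = fps_deriv (harm_fps n) * bell_fps n"
proof -
  have "fps_nth (harm_fps n) 0 = 0"
    by (simp add: harm_fps_def)
  then show ?thesis
    by (simp add: bell_fps_def fps_compose_deriv mult.commute)
qed

text \<open>The new summands 1/(n+1)^k add up to the geometric series c / (1 - c t) with c =
  1/(n+1); multiplying by 1 - c t avoids inverses.\<close>

lemma deriv_harm_fps_Suc:
  "(1 - fps_const (1 / real (Suc n)) * fps_X) * fps_deriv (harm_fps (Suc n)) =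
   (1 - fps_const (1 / real (Suc n)) * fps_X) * fps_deriv (harm_fps n) + fps_const (1 / real (Suc n))"
proof -
  have coeff: "fps_nth (fps_deriv (harm_fps m)) i = gen_harm (Suc i) m" for m i
    by (simp add: harm_fps_def del: of_nat_Suc)
  show ?thesis
  proof (rule fps_ext)
    fix m
    show "fps_nth ((1 - fps_const (1 / real (Suc n)) * fps_X) * fps_deriv (harm_fps (Suc n))) m =
      fps_nth ((1 - fps_const (1 / real (Suc n)) * fps_X) * fps_deriv (harm_fps n)
        + fps_const (1 / real (Suc n))) m"
      by (cases m) (simp_all only: fps_nth_mult_one_minus_const_X fps_add_nth fps_nth_fps_const
          coeff gen_harm_Suc, simp_all add: field_simps del: of_nat_Suc)
  qed
qed

text \<open>The coefficient form of \<open>exp (\<Sum>k\<ge>1. H\<^sub>n\<^sup>(\<^sup>k\<^sup>) t\<^sup>k / k) = (\<Prod>m=1..n. 1 / (1 - t / m))\<close>.\<close>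

lemma bell_fps_Suc:
  "bell_fps (Suc n) * (1 - fps_const (1 / real (Suc n)) * fps_X) = bell_fps n"
proof -
  define q where "q = 1 - fps_const (1 / real (Suc n)) * fps_X"
  have q': "fps_deriv q = - fps_const (1 / real (Suc n))"
    by (simp add: q_def del: of_nat_Suc)
  have "fps_deriv (bell_fps (Suc n) * q)
      = bell_fps (Suc n) * (q * fps_deriv (harm_fps (Suc n)) + fps_deriv q)"
    by (simp add: deriv_bell_fps algebra_simps)
  also have "q * fps_deriv (harm_fps (Suc n)) + fps_deriv q = q * fps_deriv (harm_fps n)"
    unfolding q' using deriv_harm_fps_Suc[of n, folded q_def] by simp
  finally have "fps_deriv (bell_fps (Suc n) * q) = fps_deriv (harm_fps n) * (bell_fps (Suc n) * q)"
    by (simp add: algebra_simps)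
  \<comment> \<open>Both series solve the same linear equation and have constant term 1.\<close>
  then have "bell_fps (Suc n) * q = bell_fps n"
    by (rule fps_linear_ode_unique[OF _ deriv_bell_fps]) (simp add: bell_fps_def q_def del: of_nat_Suc)
  then show ?thesis
    by (simp add: q_def)
qed

lemma bell_fps_0: "bell_fps 0 = 1"
proof -
  have "harm_fps 0 = 0"
    by (rule fps_ext) (simp add: harm_fps_def gen_harm_def)
  then show ?thesis
    by (simp add: bell_fps_def)
qed

lemma fps_nth_bell_fps_0: "fps_nth (bell_fps n) 0 = 1"
  by (simp add: bell_fps_def)

lemma fps_nth_bell_fps_Suc:
  "fps_nth (bell_fps (Suc n)) (Suc i) =
   fps_nth (bell_fps n) (Suc i) + fps_nth (bell_fps (Suc n)) i / real (Suc n)"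
  using fps_nth_mult_one_minus_const_X[of "1 / real (Suc n)" "bell_fps (Suc n)" "Suc i"]
  by (simp add: bell_fps_Suc mult.commute[of _ "bell_fps (Suc n)"] del: of_nat_Suc)

section \<open>Convolution of Bell and Stirling numbers\<close>

text \<open>
  The generating function of \<open>bell_stirling n j p\<close> in \<open>p\<close> is
  \<open>t (1 - t) \<dots> (j - 1 - t) / ((1 - t / 1) \<dots> (1 - t / n))\<close> for \<open>j \<ge> 1\<close>.
\<close>

definition bell_stirling :: "nat \<Rightarrow> nat \<Rightarrow> nat \<Rightarrow> real" where
  "bell_stirling n j p =
     (\<Sum>i\<le>p. (-1) ^ (p + 1 + i) * fps_nth (bell_fps n) i * real (stirling j (p - i)))"

lemma bell_stirling_0_right: "bell_stirling n (Suc j) 0 = 0"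
  by (simp add: bell_stirling_def)

text \<open>Passing from n to n + 1 divides the generating function by 1 - t/(n+1).\<close>

lemma bell_stirling_Suc_left:
  "bell_stirling (Suc n) j (Suc p) =
   bell_stirling n j (Suc p) + bell_stirling (Suc n) j p / real (Suc n)"
  by (simp add: bell_stirling_def sum.atMost_Suc_shift fps_nth_bell_fps_0 fps_nth_bell_fps_Suc
      algebra_simps sum.distrib sum_subtractf sum_negf sum_divide_distrib
      del: sum.atMost_Suc of_nat_Suc)

text \<open>The Stirling recurrence, with its alternating sign, multiplies the generating function
  by j - t.\<close>

lemma bell_stirling_Suc_middle:
  "bell_stirling n (Suc j) (Suc p) = real j * bell_stirling n j (Suc p) - bell_stirling n j p"
proof -
  have "bell_stirling n (Suc j) (Suc p) =
     (\<Sum>i\<le>p. (-1) ^ (p + i) * fps_nth (bell_fps n) i * real (stirling (Suc j) (Suc (p - i))))"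
    by (simp add: bell_stirling_def Suc_diff_le)
  also have "\<dots> = real j * (\<Sum>i\<le>p. (-1) ^ (p + i) * fps_nth (bell_fps n) i * real (stirling j (Suc (p - i))))
      - bell_stirling n j p"
    by (simp add: bell_stirling_def algebra_simps sum.distrib sum_distrib_left sum_negf)
  \<comment> \<open>The term i = p + 1 absent on the left carries s(j,0), which is 0 for j >= 1; for
    j = 0 the factor j kills both sides.\<close>
  also have "real j * (\<Sum>i\<le>p. (-1) ^ (p + i) * fps_nth (bell_fps n) i * real (stirling j (Suc (p - i))))
      = real j * bell_stirling n j (Suc p)"
    by (cases j) (simp_all add: bell_stirling_def Suc_diff_le)
  finally show ?thesis .
qed

text \<open>The factors m - t = m (1 - t/m) for m = 1, ..., n cancel the whole denominator, leaving
  n! t.\<close>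

lemma bell_stirling_diagonal:
  "bell_stirling n (Suc n) (Suc p) = (if p = 0 then fact n else 0)"
proof (induction n)
  case 0
  have "bell_stirling 0 (Suc 0) (Suc p) = - ((-1) ^ (Suc p)) * real (stirling 1 (Suc p))"
    by (simp add: bell_stirling_def bell_fps_0 sum.atMost_Suc_shift del: sum.atMost_Suc)
  then show ?case
    by (cases p) simp_all
next
  case (Suc n)
  have "bell_stirling (Suc n) (Suc (Suc n)) (Suc p) = real (Suc n) * bell_stirling n (Suc n) (Suc p)"
    by (simp add: bell_stirling_Suc_middle[of _ "Suc n"] bell_stirling_Suc_left[of n "Suc n" p]
        field_simps del: of_nat_Suc)
  then show ?case
    using Suc by simp
qed

section \<open>Star sums and their recursion\<close>

lemma star_indices_0_Suc: "star_indices 0 (Suc r) = {}"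
  by (auto simp: star_indices_def)

text \<open>The head is the largest entry, so the split is by whether it equals
  \<open>Suc n\<close>.\<close>

lemma star_indices_Suc:
  "star_indices (Suc n) (Suc r) =
   star_indices n (Suc r) \<union> (#) (Suc n) ` star_indices (Suc n) r"
proof (intro equalityI subsetI)
  fix ns assume "ns \<in> star_indices (Suc n) (Suc r)"
  then obtain a as where ns: "ns = a # as" "length as = r" "set as \<subseteq> {1..Suc n}" "1 \<le> a" "a \<le> Suc n"
    "\<forall>b\<in>set as. b \<le> a" "sorted_wrt (\<ge>) as"
    by (auto simp: star_indices_def length_Suc_conv)
  show "ns \<in> star_indices n (Suc r) \<union> (#) (Suc n) ` star_indices (Suc n) r"
  proof (cases "a = Suc n")
    case True
    then show ?thesis using ns by (auto simp: star_indices_def)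
  next
    case False
    then show ?thesis using ns by (fastforce simp: star_indices_def)
  qed
qed (fastforce simp: star_indices_def)

text \<open>The second summand collects the indices with head \<open>Suc n\<close>. In depth one
  this head is also the last entry and carries the power of z, hence the case distinction.\<close>

lemma zeta_star_Suc:
  "zeta_star (Suc n) (k # ks) z = zeta_star n (k # ks) z +
     (if ks = [] then z ^ Suc n else zeta_star (Suc n) ks z) / real (Suc n) ^ k"
proof -
  define g where "g = (\<lambda>ns. z ^ last ns / (\<Prod>i<length (k # ks). real (ns ! i) ^ ((k # ks) ! i)))"
  have disj: "star_indices n (Suc (length ks)) \<inter> (#) (Suc n) ` star_indices (Suc n) (length ks) = {}"
    by (auto simp: star_indices_def)
  have "zeta_star (Suc n) (k # ks) z = sum g (star_indices n (Suc (length ks)))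
      + sum g ((#) (Suc n) ` star_indices (Suc n) (length ks))"
    unfolding zeta_star_def g_def[symmetric]
    by (simp only: length_Cons star_indices_Suc)
       (intro sum.union_disjoint finite_imageI finite_star_indices disj)
  also have "sum g (star_indices n (Suc (length ks))) = zeta_star n (k # ks) z"
    by (simp add: zeta_star_def g_def)
  also have "sum g ((#) (Suc n) ` star_indices (Suc n) (length ks))
      = (\<Sum>ns\<in>star_indices (Suc n) (length ks). g (Suc n # ns))"
    by (subst sum.reindex) auto
  also have "\<dots> = (if ks = [] then z ^ Suc n else zeta_star (Suc n) ks z) / real (Suc n) ^ k"
  proof (cases "ks = []")
    case True
    then have "star_indices (Suc n) (length ks) = {[]}"
      by (auto simp: star_indices_def)
    then show ?thesis
      using True by (simp add: g_def)
  next
    case False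
    have "g (Suc n # ns) = z ^ last ns / (\<Prod>i<length ks. real (ns ! i) ^ (ks ! i)) / real (Suc n) ^ k"
      if "ns \<in> star_indices (Suc n) (length ks)" for ns
    proof -
      have "ns \<noteq> []"
        using that False by (auto simp: star_indices_def)
      then show ?thesis
        by (simp add: g_def prod.lessThan_Suc_shift del: prod.lessThan_Suc of_nat_Suc)
    qed
    then show ?thesis
      using False by (simp add: zeta_star_def sum_divide_distrib del: of_nat_Suc)
  qed
  finally show ?thesis .
qed

text \<open>\<open>zeta_ones 0 k z\<close> is the value that extends the recursion in \<open>p\<close> down to \<open>p = 0\<close>.\<close>

definition zeta_ones :: "nat \<Rightarrow> nat \<Rightarrow> real \<Rightarrow> real" where
  "zeta_ones p k z =
     (if k = 0 then 0 else if p = 0 then z ^ k else zeta_star k (replicate p 1) z)"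

lemma zeta_ones_eq_zeta_star: "zeta_ones (Suc p) k z = zeta_star k (replicate (Suc p) 1) z"
  by (simp add: zeta_ones_def zeta_star_def star_indices_0_Suc)

text \<open>For p = 0 the power of z left over in \<open>zeta_star_Suc\<close> is exactly
  \<open>zeta_ones 0 (Suc k) z\<close>.\<close>

lemma zeta_ones_Suc:
  "zeta_ones (Suc p) (Suc k) z = zeta_ones (Suc p) k z + zeta_ones p (Suc k) z / real (Suc k)"
  by (simp add: zeta_ones_eq_zeta_star zeta_star_Suc) (simp add: zeta_ones_def)

section \<open>Binomial transforms\<close>

definition binomial_transform :: "real \<Rightarrow> real \<Rightarrow> (nat \<Rightarrow> real) \<Rightarrow> nat \<Rightarrow> real" where
  "binomial_transform x y f n = (\<Sum>k\<le>n. real (n choose k) * x ^ k * y ^ (n - k) * f k)"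

lemma binomial_transform_Suc:
  "binomial_transform x y f (Suc n) =
   y * binomial_transform x y f n + x * binomial_transform x y (\<lambda>k. f (Suc k)) n"
proof -
  \<comment> \<open>The extra summand k = n + 1 is 0 because its binomial coefficient vanishes; the
    range now fits Pascal's rule.\<close>
  have "y * binomial_transform x y f n = (\<Sum>k\<le>Suc n. real (n choose k) * x ^ k * y ^ (Suc n - k) * f k)"
    by (simp add: binomial_transform_def sum_distrib_left Suc_diff_le mult_ac)
  then show ?thesis
    by (simp add: binomial_transform_def sum.atMost_Suc_shift algebra_simps sum.distrib
        sum_distrib_left del: sum.atMost_Suc)
qed

text \<open>Absorption trades 1/(k+1) for 1/(n+1); \<open>g 0 = 0\<close> removes the summand k = 0
  left over by the index shift.\<close>

lemma binomial_transform_absorb: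
  assumes "g 0 = 0"
  shows "x * binomial_transform x y (\<lambda>k. g (Suc k) / real (Suc k)) n
    = binomial_transform x y g (Suc n) / real (Suc n)"
proof -
  have choose: "real (Suc n choose Suc k) / real (Suc n) = real (n choose k) / real (Suc k)" for k
    using arg_cong[OF Suc_times_binomial[of k n], of real]
    by (simp only: of_nat_mult) (simp add: field_simps del: of_nat_Suc)
  have "real (Suc n choose Suc k) * x ^ Suc k * y ^ (n - k) * g (Suc k) / real (Suc n)
      = x * (real (n choose k) * x ^ k * y ^ (n - k) * (g (Suc k) / real (Suc k)))" for k
  proof -
    have "real (Suc n choose Suc k) * x ^ Suc k * y ^ (n - k) * g (Suc k) / real (Suc n)
        = real (Suc n choose Suc k) / real (Suc n) * (x * (x ^ k * y ^ (n - k) * g (Suc k)))"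
      by (simp del: binomial_Suc_Suc of_nat_Suc)
    then show ?thesis
      unfolding choose by simp
  qed
  then show ?thesis
    using assms by (simp add: binomial_transform_def sum.atMost_Suc_shift sum_distrib_left
        sum_divide_distrib del: sum.atMost_Suc binomial_Suc_Suc of_nat_Suc)
qed

lemma binomial_transform_zeta_ones_Suc:
  "binomial_transform x y (\<lambda>k. zeta_ones (Suc p) k z) (Suc n) =
   (x + y) * binomial_transform x y (\<lambda>k. zeta_ones (Suc p) k z) n
   + binomial_transform x y (\<lambda>k. zeta_ones p k z) (Suc n) / real (Suc n)"
proof -
  have "binomial_transform x y (\<lambda>k. zeta_ones (Suc p) (Suc k) z) n
      = binomial_transform x y (\<lambda>k. zeta_ones (Suc p) k z) n
      + binomial_transform x y (\<lambda>k. zeta_ones p (Suc k) z / real (Suc k)) n"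
    by (simp add: binomial_transform_def zeta_ones_Suc distrib_left sum.distrib del: of_nat_Suc)
  \<comment> \<open>Every transform at \<open>Suc n\<close> gets expanded, so absorption is supplied
    in expanded form and read from right to left.\<close>
  then show ?thesis
    by (simp add: binomial_transform_Suc[of x y _ n] distrib_left distrib_right
        binomial_transform_absorb[of "\<lambda>k. zeta_ones p k z", unfolded binomial_transform_Suc, symmetric]
        zeta_ones_def[of _ 0] del: of_nat_Suc)
qed

text \<open>As \<open>zeta_ones 0 0 z\<close> is 0 and not z^0 = 1, the binomial expansion lacks
  just its summand y^n.\<close>

lemma binomial_transform_zeta_ones_0:
  "binomial_transform x y (\<lambda>k. zeta_ones 0 k z) n = (x * z + y) ^ n - y ^ n"
proof -
  have "(x * z + y) ^ n = (\<Sum>k\<le>n. real (n choose k) * x ^ k * y ^ (n - k) * z ^ k)"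
    by (simp add: binomial_ring power_mult_distrib mult_ac)
  moreover have "y ^ n = (\<Sum>k\<le>n. if k = 0 then y ^ n else 0)"
    by simp
  ultimately have "(x * z + y) ^ n - y ^ n = (\<Sum>k\<le>n.
      real (n choose k) * x ^ k * y ^ (n - k) * z ^ k - (if k = 0 then y ^ n else 0))"
    by (simp only: sum_subtractf)
  then show ?thesis
    by (auto simp: binomial_transform_def zeta_ones_def intro!: sum.cong)
qed

section \<open>Comparison of the two sides\<close>

lemma binomial_transform_zeta_ones:
  fixes x y z :: real
  assumes "x + y \<noteq> 0"
  defines "w \<equiv> \<lambda>j. ((x * z + y) / (x + y)) ^ j - (y / (x + y)) ^ j"
  shows "binomial_transform x y (\<lambda>k. zeta_ones (Suc p) k z) n =
    (x + y) ^ n * (\<Sum>j=1..n. w j * (bell_stirling n j (Suc p) / fact j))"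
proof -
  define R where "R = (\<lambda>n p. (x + y) ^ n * (\<Sum>j=1..n. w j * (bell_stirling n j p / fact j)))"
  have R_0: "R n 0 = 0" for n
    unfolding R_def by (auto intro!: sum.neutral simp: bell_stirling_0_right dest!: Suc_le_D)
  have R_Suc: "R (Suc n) (Suc p) = (x + y) * R n (Suc p) + R (Suc n) p / real (Suc n)
      + (if p = 0 then ((x * z + y) ^ Suc n - y ^ Suc n) / real (Suc n) else 0)" for n p
  proof -
    \<comment> \<open>The index j = n + 1 lies beyond the range of \<open>R n (Suc p)\<close>. Its
      contribution survives only for p = 0, where it replaces the nonzero row 0 of the left-hand
      side, since \<open>R\<close> vanishes there.\<close>
    have top: "(x + y) ^ Suc n * (w (Suc n) * (bell_stirling n (Suc n) (Suc p) / fact (Suc n)))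
        = (if p = 0 then ((x * z + y) ^ Suc n - y ^ Suc n) / real (Suc n) else 0)"
    proof -
      have "(x + y) ^ Suc n * w (Suc n) = (x * z + y) ^ Suc n - y ^ Suc n"
        using assms(1) by (simp only: w_def power_divide right_diff_distrib) simp
      moreover have "fact n / fact (Suc n) = 1 / real (Suc n)"
        by simp
      moreover have "(x + y) ^ Suc n * (w (Suc n) * (bell_stirling n (Suc n) (Suc p) / fact (Suc n)))
          = ((x + y) ^ Suc n * w (Suc n)) * (if p = 0 then fact n / fact (Suc n) else 0)"
        by (simp add: bell_stirling_diagonal del: of_nat_Suc fact_Suc power_Suc)
      ultimately show ?thesis
        by (simp only: split: if_split) simp
    qed
    have "R (Suc n) (Suc p) =
      (x + y) ^ Suc n * (\<Sum>j=1..Suc n. w j * (bell_stirling n j (Suc p) / fact j))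
      + R (Suc n) p / real (Suc n)"
      unfolding R_def bell_stirling_Suc_left
      by (simp add: add_divide_distrib distrib_left sum.distrib sum_divide_distrib sum_distrib_left
          mult_ac del: of_nat_Suc sum.cl_ivl_Suc power_Suc fact_Suc)
    also have "(\<Sum>j=1..Suc n. w j * (bell_stirling n j (Suc p) / fact j))
      = (\<Sum>j=1..n. w j * (bell_stirling n j (Suc p) / fact j))
        + w (Suc n) * (bell_stirling n (Suc n) (Suc p) / fact (Suc n))"
      by (simp del: fact_Suc)
    finally show ?thesis
      unfolding distrib_left top by (simp add: R_def mult.assoc)
  qed
  \<comment> \<open>Induction on p with an inner induction on n; at n = 0 both sides are 0.\<close>
  have "binomial_transform x y (\<lambda>k. zeta_ones (Suc p) k z) n = R n (Suc p)" for n p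
  proof (induction p arbitrary: n)
    case 0
    show ?case
      by (induction n)
        (simp add: binomial_transform_def zeta_ones_def R_def,
         simp only: binomial_transform_zeta_ones_Suc R_Suc R_0 binomial_transform_zeta_ones_0, simp)
  next
    case (Suc p)
    show ?case
      by (induction n)
        (simp add: binomial_transform_def zeta_ones_def R_def,
         simp add: binomial_transform_zeta_ones_Suc[of x y "Suc p"] R_Suc[of _ "Suc p"] Suc)
  qed
  then show ?thesis
    by (simp add: R_def)
qed

text \<open>The top term i = p + 1 of the convolution drops out because s(j+1,0) = 0.\<close>

lemma bell_stirling_eq_bell_number:
  "bell_stirling n (Suc j) (Suc p) =
   (-1) ^ p * (\<Sum>i=0..p. (-1) ^ i * (bell_number i n / fact i) * real (stirling (Suc j) (Suc p - i)))"
  by (simp add: bell_stirling_def bell_number_eq_fps_nth sum_distrib_left power_add mult_ac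
      atLeast0AtMost del: stirling.simps(4))

theorem theorem1p1:
  fixes x y z :: real and n p :: nat
  assumes "x + y \<noteq> 0" and "x / (x + y) \<ge> 0" and "z \<le> 1" and "n \<ge> 1" and "p \<ge> 1"
  shows "(\<Sum>k=0..n. x ^ k * y ^ (n - k) * real (n choose k) * zeta_star k (replicate p 1) z)
    = (-1) ^ (p - 1) * (x + y) ^ n *
      (\<Sum>j=1..n. (((x * z + y) / (x + y)) ^ j - (y / (x + y)) ^ j) *
         (\<Sum>i=0..p-1. (-1) ^ i * (bell_number i n / fact i) * (real (stirling j (p - i)) / fact j)))"
proof -
  obtain q where p: "p = Suc q"
    using assms(5) by (cases p) auto
  define w where "w = (\<lambda>j. ((x * z + y) / (x + y)) ^ j - (y / (x + y)) ^ j)"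
  have inner: "bell_stirling n j (Suc q) / fact j = (-1) ^ q *
      (\<Sum>i=0..q. (-1) ^ i * (bell_number i n / fact i) * (real (stirling j (Suc q - i)) / fact j))"
    if j: "j \<in> {1..n}" for j
  proof -
    obtain j' where "j = Suc j'"
      using j by (cases j) auto
    then show ?thesis
      by (simp only: bell_stirling_eq_bell_number times_divide_eq_right[symmetric] sum_divide_distrib)
  qed
  have "(\<Sum>k=0..n. x ^ k * y ^ (n - k) * real (n choose k) * zeta_star k (replicate p 1) z)
      = binomial_transform x y (\<lambda>k. zeta_ones (Suc q) k z) n"
    by (simp only: binomial_transform_def zeta_ones_eq_zeta_star p atLeast0AtMost mult_ac)
  also have "\<dots> = (x + y) ^ n * (\<Sum>j=1..n. w j * (bell_stirling n j (Suc q) / fact j))"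
    unfolding w_def by (rule binomial_transform_zeta_ones[OF assms(1)])
  also have "\<dots> = (x + y) ^ n * (\<Sum>j=1..n. w j * ((-1) ^ q *
      (\<Sum>i=0..q. (-1) ^ i * (bell_number i n / fact i) * (real (stirling j (Suc q - i)) / fact j))))"
    using inner by simp
  also have "\<dots> = (-1) ^ q * (x + y) ^ n * (\<Sum>j=1..n. w j *
      (\<Sum>i=0..q. (-1) ^ i * (bell_number i n / fact i) * (real (stirling j (Suc q - i)) / fact j)))"
    by (simp only: sum_distrib_left mult_ac)
  finally show ?thesis
    by (simp add: p w_def)
qed

end
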